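(* Assume the axiom of choice. Let $\Theta$ be a non-empty set, let $\mathcal{P},\mathcal{V}$ be sets, let $P:\Theta\to\mathcal{P}$ be a function (the forward mapping) and let $q:\Theta\to\mathcal{V}$ be a function (a parameter). Then $q$ is identifiable with respect to $P$ if and only if there exists a Fisher consistent estimator $t:\mathcal{P}\to\mathcal{V}$ for $q$.
   Context: $\Theta$ is an arbitrary set of "models", $\mathcal{P}$ a set of probability distributions over observable variables, and $\mathcal{V}$ a set of parameter values; no further structure on these sets is used. Write $\mathcal{R}(q)=\{q(\theta):\theta\in\Theta\}$ for the range of $q$. Identifiability: the parameter $q$ is identifiable with respect to $P$ iff for all $\theta_1\neq\theta_2$ in $\Theta$, $P(\theta_1)=P(\theta_2)$ implies $q(\theta_1)=q(\theta_2)$. Fisher consistency for parameters: a functional estimator for $q$ is a function $t:\mathcal{P}\to\mathcal{V}$. It is Fisher consistent for $q$ iff for every function $s:\mathcal{R}(q)\to\Theta$ satisfying $q(s(v))=v$ for all $v\in\mathcal{R}(q)$, one has $t(P(s(v)))=v$ for all $v\in\mathcal{R}(q)$. (The same $t$ must work for all such $s$.) *)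

theory Defs
  imports "HOL-Library.FuncSet"
begin

text \<open>
  A function from a set \<open>A\<close> to a set \<open>B\<close> is represented by a total HOL function in \<open>A \<rightarrow> B\<close>;
  its values outside \<open>A\<close> are irrelevant, since everything below only evaluates it on \<open>A\<close>.
\<close>

definition identifiable :: "'m set \<Rightarrow> ('m \<Rightarrow> 'p) \<Rightarrow> ('m \<Rightarrow> 'v) \<Rightarrow> bool" where
  "identifiable \<Theta> P q \<longleftrightarrow>
    (\<forall>\<theta>\<^sub>1\<in>\<Theta>. \<forall>\<theta>\<^sub>2\<in>\<Theta>. \<theta>\<^sub>1 \<noteq> \<theta>\<^sub>2 \<longrightarrow> P \<theta>\<^sub>1 = P \<theta>\<^sub>2 \<longrightarrow> q \<theta>\<^sub>1 = q \<theta>\<^sub>2)"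

definition functional_estimator :: "'p set \<Rightarrow> 'v set \<Rightarrow> ('p \<Rightarrow> 'v) \<Rightarrow> bool" where
  "functional_estimator \<P> \<V> t \<longleftrightarrow> t \<in> \<P> \<rightarrow> \<V>"

text \<open>The range of the parameter \<open>q\<close> is the image \<open>q ` \<Theta>\<close>.\<close>

definition fisher_consistent ::
    "'m set \<Rightarrow> ('m \<Rightarrow> 'p) \<Rightarrow> ('m \<Rightarrow> 'v) \<Rightarrow> ('p \<Rightarrow> 'v) \<Rightarrow> bool" where
  "fisher_consistent \<Theta> P q t \<longleftrightarrow>
    (\<forall>s \<in> q ` \<Theta> \<rightarrow> \<Theta>. (\<forall>v \<in> q ` \<Theta>. q (s v) = v) \<longrightarrow> (\<forall>v \<in> q ` \<Theta>. t (P (s v)) = v))"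

end

theory Submission
  imports Defs
begin

text \<open>Every model is the value of some section of \<open>q\<close>, so testing
  \<open>t\<close> on all sections amounts to testing it on all models: Fisher consistency is the
  pointwise equation t(P(\<theta>)) = q(\<theta>) on \<open>\<Theta>\<close>
  (\<open>fisher_consistent_iff\<close>). An estimator therefore exists exactly when
  \<open>q\<close> factors through \<open>P\<close>, that is, when \<open>q\<close> is constant on
  the fibres of \<open>P\<close>, which is identifiability.\<close>

text \<open>Quantifying over all sections is essential from left to right: a single section tests
  only one model per value of \<open>q\<close>. To reach a given model, an arbitrary section is
  redirected at one value.\<close>

lemma fisher_consistent_iff:
  "fisher_consistent \<Theta> P q t \<longleftrightarrow> (\<forall>\<theta>\<in>\<Theta>. t (P \<theta>) = q \<theta>)"
proof
  assume t: "fisher_consistent \<Theta> P q t"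
  show "\<forall>\<theta>\<in>\<Theta>. t (P \<theta>) = q \<theta>"
  proof
    fix \<theta> assume \<theta>: "\<theta> \<in> \<Theta>"
    \<comment> \<open>By choice, \<open>q\<close> has a section through any prescribed model \<open>\<theta>\<close>.\<close>
    define s where "s = (inv_into \<Theta> q)(q \<theta> := \<theta>)"
    have "s \<in> q ` \<Theta> \<rightarrow> \<Theta>"
      using \<theta> by (auto simp: s_def inv_into_into)
    moreover have "\<forall>v \<in> q ` \<Theta>. q (s v) = v"
      by (auto simp: s_def f_inv_into_f)
    ultimately have "t (P (s (q \<theta>))) = q \<theta>"
      using t \<theta> unfolding fisher_consistent_def by blast
    then show "t (P \<theta>) = q \<theta>"
      by (simp add: s_def)
  qed
next
  assume t: "\<forall>\<theta>\<in>\<Theta>. t (P \<theta>) = q \<theta>"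
  show "fisher_consistent \<Theta> P q t"
    unfolding fisher_consistent_def
  proof (intro ballI impI)
    fix s v
    assume "s \<in> q ` \<Theta> \<rightarrow> \<Theta>" "\<forall>v \<in> q ` \<Theta>. q (s v) = v" "v \<in> q ` \<Theta>"
    then have "s v \<in> \<Theta>" "q (s v) = v"
      by blast+
    with t show "t (P (s v)) = v"
      by simp
  qed
qed

theorem theorem19:
  fixes \<Theta> :: "'m set" and \<P> :: "'p set" and \<V> :: "'v set"
    and P :: "'m \<Rightarrow> 'p" and q :: "'m \<Rightarrow> 'v"
  assumes "\<Theta> \<noteq> {}"
    and "P \<in> \<Theta> \<rightarrow> \<P>"
    and "q \<in> \<Theta> \<rightarrow> \<V>"
  shows "identifiable \<Theta> P q \<longleftrightarrow>
    (\<exists>t. functional_estimator \<P> \<V> t \<and> fisher_consistent \<Theta> P q t)"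
proof
  assume id: "identifiable \<Theta> P q"
  obtain \<theta>\<^sub>0 where \<theta>\<^sub>0: "\<theta>\<^sub>0 \<in> \<Theta>"
    using assms(1) by blast
  \<comment> \<open>On the range of \<open>P\<close>, choice picks a model in the fibre over
    \<open>p\<close>. Off the range only membership in \<open>\<V>\<close> matters; the fixed model
    supplies such a value even when \<open>p\<close> comes from no model.\<close>
  define t where "t p = (if p \<in> P ` \<Theta> then q (inv_into \<Theta> P p) else q \<theta>\<^sub>0)" for p
  have "t p \<in> \<V>" for p
    using assms(3) \<theta>\<^sub>0 inv_into_into[of p P \<Theta>] by (auto simp: t_def)
  then have "functional_estimator \<P> \<V> t"
    by (simp add: functional_estimator_def)
  moreover have "t (P \<theta>) = q \<theta>" if "\<theta> \<in> \<Theta>" for \<theta>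
  proof -
    have "inv_into \<Theta> P (P \<theta>) \<in> \<Theta>" "P (inv_into \<Theta> P (P \<theta>)) = P \<theta>"
      using that by (simp_all add: inv_into_into f_inv_into_f)
    \<comment> \<open>The chosen model may differ from \<open>\<theta>\<close>, but both lie in the
      same fibre of \<open>P\<close>, so identifiability makes the choice harmless.\<close>
    then have "q (inv_into \<Theta> P (P \<theta>)) = q \<theta>"
      using id that unfolding identifiable_def by metis
    with that show ?thesis
      by (simp add: t_def)
  qed
  ultimately show "\<exists>t. functional_estimator \<P> \<V> t \<and> fisher_consistent \<Theta> P q t"
    by (auto simp: fisher_consistent_iff)
next
  assume "\<exists>t. functional_estimator \<P> \<V> t \<and> fisher_consistent \<Theta> P q t"
  then obtain t where "\<forall>\<theta>\<in>\<Theta>. t (P \<theta>) = q \<theta>"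
    by (auto simp: fisher_consistent_iff)
  \<comment> \<open>Models with equal images under \<open>P\<close> give \<open>t\<close> the same
    argument, hence have the same \<open>q\<close>.\<close>
  then show "identifiable \<Theta> P q"
    unfolding identifiable_def by metis
qed

end
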